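(* Consider a multiplex network with $n$ physical nodes and $L$ layers, resolution parameters $\gamma^{(\ell)}>0$, and a fixed number $n_c\in\mathbb{N}$ of communities (notation as in the context). Let $\mathcal{P}=\{\bm{U}\in\{0,1\}^{nL\times n_c} : \bm{U}\bm{1}_{n_c}=\bm{1}_{nL}\}$. Then the following three optimization problems over $\bm{U}\in\mathcal{P}$ are equivalent (they have the same set of optimal $\bm{U}$): 1. Maximizing multiplex modularity: $$\max_{\bm{U}\in\mathcal{P}} Q(\bm{U}),\qquad Q(\bm{U})=\frac{1}{2\mu}\,\mathrm{tr}\left(\bm{U}^T\bm{M}\bm{U}\right).$$ 2. Minimizing the balanced multiplex graph cut: $$\min_{\bm{U}\in\mathcal{P}}\ \sum_{r=1}^{n_c}\mathrm{Cut}_{\mathrm{MP}}(S_r,S_r^C)+\sum_{r=1}^{n_c}\sum_{\ell=1}^{L}\frac{\gamma^{(\ell)}}{2m^{(\ell)}}\sum_{i\in S_r^{(\ell)}}\bm{d}^{(\ell)}_{i}\,\mathrm{vol}(S_r^{(\ell)}).$$ 3. Minimizing the balanced multiplex total variation functional: $$\min_{\bm{U}\in\mathcal{P}}\ |\bm{U}|_{\mathrm{MPTV}}+\sum_{\ell=1}^{L}\frac{\gamma^{(\ell)}}{2m^{(\ell)}}\left\|(\bm{d}^{(\ell)})^T\bm{U}^{(\ell)}\right\|_2^2.$$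
   Context: Multiplex network. Let $n,L\in\mathbb{N}$. For $\ell=1,\dots,L$ let $\bm{A}^{(\ell)}\in\mathbb{R}_{\ge 0}^{n\times n}$ be symmetric (intra-layer adjacency matrices). Let $\widetilde{\bm{A}}\in\mathbb{R}_{\ge 0}^{L\times L}$ be symmetric with zero diagonal (layer coupling matrix), $\omega\ge 0$ the inter-layer coupling parameter, and $\bm{C}^{(k\ell)}=\omega\widetilde{\bm{A}}_{k\ell}\bm{I}\in\mathbb{R}^{n\times n}$ for $k\ne\ell$. The supra-adjacency matrix is $\bm{A}=\mathrm{blkdiag}[\bm{A}^{(1)},\dots,\bm{A}^{(L)}]+\omega\widetilde{\bm{A}}\otimes\bm{I}\in\mathbb{R}_{\ge 0}^{nL\times nL}$, i.e. the $L\times L$ block matrix with diagonal blocks $\bm{A}^{(\ell)}$ and off-diagonal blocks $\bm{C}^{(k\ell)}$. The set of node-layer pairs is $\mathcal{V}=\{(j,\ell): j=1,\dots,n,\ \ell=1,\dots,L\}$; the pair $(j,\ell)$ corresponds to row/column index $(\ell-1)n+j$. $\bm{1}_p$ is the all-ones vector in $\mathbb{R}^p$. Degrees and strengths. $\bm{d}^{(\ell)}=\bm{A}^{(\ell)}\bm{1}_n\in\mathbb{R}^n$ is the intra-layer degree vector, $2m^{(\ell)}=\bm{1}_n^T\bm{A}^{(\ell)}\bm{1}_n$ (assumed positive for every $\ell$), and $2\mu=\bm{1}_{nL}^T\bm{A}\bm{1}_{nL}$. Multiplex modularity matrix. $\bm{M}\in\mathbb{R}^{nL\times nL}$ is the $L\times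 L$ block matrix with diagonal blocks $\bm{M}^{(\ell)}=\bm{A}^{(\ell)}-\frac{\gamma^{(\ell)}}{2m^{(\ell)}}\bm{d}^{(\ell)}(\bm{d}^{(\ell)})^T$ and off-diagonal blocks $\bm{C}^{(k\ell)}$, $k\neq\ell$. Partitions. A matrix $\bm{U}\in\{0,1\}^{nL\times n_c}$ with $\bm{U}\bm{1}_{n_c}=\bm{1}_{nL}$ has one-hot rows and encodes the partition of $\mathcal{V}$ into the disjoint sets $S_r$, $r=1,\dots,n_c$, where $(j,\ell)\in S_r$ iff row $(\ell-1)n+j$ of $\bm{U}$ equals $\bm{e}_r^T$. $\bm{U}^{(\ell)}\in\{0,1\}^{n\times n_c}$ is the block of rows of $\bm{U}$ belonging to layer $\ell$; $S_r^{(\ell)}$ is the set of nodes $j\in\{1,\dots,n\}$ with $(j,\ell)\in S_r$; $S_r^C=\mathcal{V}\setminus S_r$. Volume, cut, total variation. $\mathrm{vol}(S_r^{(\ell)})=\sum_{j\in S_r^{(\ell)}}\bm{d}^{(\ell)}_j$; $$\mathrm{Cut}_{\mathrm{MP}}(S_r,S_r^C)=\sum_{(i,k)\in S_r,\ (j,\ell)\in S_r^C}\bm{A}_{(k-1)n+i,(\ell-1)n+j};$$ $$|\bm{U}|_{\mathrm{MPTV}}=\frac12\sum_{i,j=1}^n\sum_{k,\ell=1}^L\bm{A}_{(k-1)n+i,(\ell-1)n+j}\,\bigl\|\bm{U}_{(k-1)n+i,:}-\bm{U}_{(\ell-1)n+j,:}\bigr\|_1,$$ where $\bm{U}_{p,:}$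 denotes the $p$-th row of $\bm{U}$; for partitions this equals $\sum_{r=1}^{n_c}\mathrm{Cut}_{\mathrm{MP}}(S_r,S_r^C)$. *)

theory Defs
  imports "HOL-Analysis.Analysis"
begin

text \<open>
  The index types \<open>'n\<close>, \<open>'l\<close>, \<open>'c\<close> stand for the \<open>n\<close> physical nodes, the \<open>L\<close> layers and the
  \<open>n\<^sub>c\<close> communities. Node-layer pairs \<open>(j, \<ell>)\<close> are elements of \<open>'n \<times> 'l\<close> and index the supra-matrices
  directly; in the usual flat numbering \<open>(j, \<ell>)\<close> is row \<open>(\<ell> - 1) n + j\<close>, so the layer is the block index.
  The vector \<open>1\<close> of type \<open>real ^ 'p\<close> is the all-ones vector, and \<open>mat 1\<close> is the identity matrix.
\<close>

definition block_matrix :: "('l::finite \<Rightarrow> 'l \<Rightarrow> real^'n^'n) \<Rightarrow> real^('n \<times> 'l)^('n \<times> 'l)" where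
  "block_matrix B = (\<chi> p q. B (snd p) (snd q) $ fst p $ fst q)"

definition blkdiag :: "('l::finite \<Rightarrow> real^'n^'n) \<Rightarrow> real^('n \<times> 'l)^('n \<times> 'l)" where
  "blkdiag B = block_matrix (\<lambda>k l. if k = l then B l else 0)"

definition kronecker :: "real^'l^'l \<Rightarrow> real^'n^'n \<Rightarrow> real^('n \<times> 'l)^('n \<times> 'l)" where
  "kronecker X Y = block_matrix (\<lambda>k l. (X $ k $ l) *\<^sub>R Y)"

definition supra_adjacency ::
    "('l::finite \<Rightarrow> real^'n^'n) \<Rightarrow> real^'l^'l \<Rightarrow> real \<Rightarrow> real^('n \<times> 'l)^('n \<times> 'l)" where
  "supra_adjacency A At \<omega> = blkdiag A + \<omega> *\<^sub>R kronecker At (mat 1)"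

definition degree :: "real^'p^'p \<Rightarrow> real^'p" where
  "degree X = X *v 1"

text \<open>\<open>m\<^sup>(\<^sup>\<ell>\<^sup>)\<close> for an intra-layer adjacency matrix, \<open>\<mu>\<close> for the supra-adjacency matrix.\<close>

definition edge_weight :: "real^'p^'p \<Rightarrow> real" where
  "edge_weight X = (1 \<bullet> (X *v 1)) / 2"

definition layer_modularity :: "real^'n^'n \<Rightarrow> real \<Rightarrow> real^'n^'n" where
  "layer_modularity X g =
     X - (g / (2 * edge_weight X)) *\<^sub>R (\<chi> i j. degree X $ i * degree X $ j)"

definition modularity_matrix ::
    "('l::finite \<Rightarrow> real^'n^'n) \<Rightarrow> real^'l^'l \<Rightarrow> real \<Rightarrow> ('l \<Rightarrow> real) \<Rightarrow> real^('n \<times> 'l)^('n \<times> 'l)" where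
  "modularity_matrix A At \<omega> \<gamma> =
     block_matrix (\<lambda>k l. if k = l then layer_modularity (A l) (\<gamma> l)
                         else (\<omega> * At $ k $ l) *\<^sub>R mat 1)"

definition partition_matrices :: "(real^'c^('n::finite \<times> 'l::finite)) set" where
  "partition_matrices = {U. (\<forall>p r. U $ p $ r \<in> {0, 1}) \<and> U *v 1 = 1}"

definition community :: "real^'c^('n::finite \<times> 'l::finite) \<Rightarrow> 'c \<Rightarrow> ('n \<times> 'l) set" where
  "community U r = {p. U $ p = axis r 1}"

definition layer_community :: "real^'c^('n::finite \<times> 'l::finite) \<Rightarrow> 'c \<Rightarrow> 'l \<Rightarrow> 'n set" where
  "layer_community U r l = {j. (j, l) \<in> community U r}"

definition layer_block :: "real^'c^('n::finite \<times> 'l::finite) \<Rightarrow> 'l \<Rightarrow> real^'c^'n" where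
  "layer_block U l = (\<chi> j. U $ (j, l))"

definition volume :: "real^'n^'n \<Rightarrow> 'n set \<Rightarrow> real" where
  "volume X S = (\<Sum>j\<in>S. degree X $ j)"

definition mp_cut ::
    "('l::finite \<Rightarrow> real^'n^'n) \<Rightarrow> real^'l^'l \<Rightarrow> real \<Rightarrow> ('n \<times> 'l) set \<Rightarrow> ('n \<times> 'l) set \<Rightarrow> real" where
  "mp_cut A At \<omega> S T = (\<Sum>p\<in>S. \<Sum>q\<in>T. supra_adjacency A At \<omega> $ p $ q)"

definition mp_total_variation ::
    "('l::finite \<Rightarrow> real^'n^'n) \<Rightarrow> real^'l^'l \<Rightarrow> real \<Rightarrow> real^'c^('n \<times> 'l) \<Rightarrow> real" where
  "mp_total_variation A At \<omega> U =
     1/2 * (\<Sum>i\<in>UNIV. \<Sum>j\<in>UNIV. \<Sum>k\<in>UNIV. \<Sum>l\<in>UNIV.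
       supra_adjacency A At \<omega> $ (i, k) $ (j, l) * (\<Sum>r\<in>UNIV. \<bar>U $ (i, k) $ r - U $ (j, l) $ r\<bar>))"

definition modularity ::
    "('l::finite \<Rightarrow> real^'n^'n) \<Rightarrow> real^'l^'l \<Rightarrow> real \<Rightarrow> ('l \<Rightarrow> real) \<Rightarrow> real^'c^('n \<times> 'l) \<Rightarrow> real" where
  "modularity A At \<omega> \<gamma> U =
     1 / (2 * edge_weight (supra_adjacency A At \<omega>))
       * trace (transpose U ** modularity_matrix A At \<omega> \<gamma> ** U)"

definition balanced_cut ::
    "('l::finite \<Rightarrow> real^'n^'n) \<Rightarrow> real^'l^'l \<Rightarrow> real \<Rightarrow> ('l \<Rightarrow> real) \<Rightarrow> real^'c^('n \<times> 'l) \<Rightarrow> real" where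
  "balanced_cut A At \<omega> \<gamma> U =
     (\<Sum>r\<in>UNIV. mp_cut A At \<omega> (community U r) (- community U r))
     + (\<Sum>r\<in>UNIV. \<Sum>l\<in>UNIV. \<gamma> l / (2 * edge_weight (A l))
         * (\<Sum>i\<in>layer_community U r l. degree (A l) $ i * volume (A l) (layer_community U r l)))"

definition balanced_total_variation ::
    "('l::finite \<Rightarrow> real^'n^'n) \<Rightarrow> real^'l^'l \<Rightarrow> real \<Rightarrow> ('l \<Rightarrow> real) \<Rightarrow> real^'c^('n \<times> 'l) \<Rightarrow> real" where
  "balanced_total_variation A At \<omega> \<gamma> U =
     mp_total_variation A At \<omega> U
     + (\<Sum>l\<in>UNIV. \<gamma> l / (2 * edge_weight (A l)) * (norm (degree (A l) v* layer_block U l))\<^sup>2)"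

end

theory Submission
  imports Defs
begin

text \<open>
  On partition matrices both the cut and the total variation equal \<open>2 \<mu> - tr (U\<^sup>T A U)\<close>, and both
  penalty terms equal the trace of \<open>U\<^sup>T (A - M) U\<close>. Hence both balanced objectives coincide there
  with \<open>2 \<mu> (1 - Q(U))\<close>, a strictly decreasing function of the modularity because \<open>\<mu> > 0\<close>.
\<close>

text \<open>The common normal form of the proof: one quadratic form per column of \<open>U\<close>.
  Cut, total variation and modularity are all brought to this shape before they are
  compared.\<close>

lemma trace_congruence:
  fixes X :: "real^'p^'p" and U :: "real^'c^'p"
  shows "trace (transpose U ** X ** U) =
    (\<Sum>r\<in>UNIV. \<Sum>p\<in>UNIV. \<Sum>q\<in>UNIV. X $ p $ q * (U $ p $ r * U $ q $ r))"
proof -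
  have "trace (transpose U ** X ** U) =
      (\<Sum>r\<in>UNIV. \<Sum>q\<in>UNIV. \<Sum>p\<in>UNIV. X $ p $ q * (U $ p $ r * U $ q $ r))"
    by (simp add: trace_def matrix_matrix_mult_def transpose_def
        sum_distrib_left sum_distrib_right mult_ac)
  also have "\<dots> = (\<Sum>r\<in>UNIV. \<Sum>p\<in>UNIV. \<Sum>q\<in>UNIV. X $ p $ q * (U $ p $ r * U $ q $ r))"
    by (intro sum.cong refl sum.swap)
  finally show ?thesis .
qed

lemma is_arg_min_cong:
  assumes "\<And>x. P x \<Longrightarrow> f x = g x"
  shows "is_arg_min f P = is_arg_min g P"
  using assms by (auto simp: is_arg_min_def fun_eq_iff)

text \<open>An affine map of negative slope reverses the order. The relation between
  \<open>f\<close> and \<open>g\<close> is needed on feasible points only, which matters because the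
  objectives here are related only on partition matrices.\<close>

lemma is_arg_max_iff_is_arg_min:
  fixes f g :: "'a \<Rightarrow> real"
  assumes "c > 0" and "\<And>x. P x \<Longrightarrow> g x = a - c * f x"
  shows "is_arg_max f P x \<longleftrightarrow> is_arg_min g P x"
  using assms by (auto simp: is_arg_max_def is_arg_min_def)

lemma sum_UNIV_prod:
  fixes f :: "'a::finite \<times> 'b::finite \<Rightarrow> real"
  shows "sum f UNIV = (\<Sum>i\<in>UNIV. \<Sum>l\<in>UNIV. f (i, l))"
  by (simp add: sum.cartesian_product flip: UNIV_Times_UNIV)

lemma one_inner_matrix_one:
  fixes X :: "real^'p^'p"
  shows "1 \<bullet> (X *v 1) = (\<Sum>p\<in>UNIV. \<Sum>q\<in>UNIV. X $ p $ q)"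
  by (simp add: inner_vec_def matrix_vector_mult_def)

section \<open>Cut, total variation and volume of a partition in terms of matrix entries\<close>

context
  fixes U :: "real^'c^('n::finite \<times> 'l::finite)"
  assumes U: "U \<in> partition_matrices"
begin

lemma partition_entry: "U $ p $ r = 0 \<or> U $ p $ r = 1"
  using U by (simp add: partition_matrices_def del: split_paired_All)

lemma partition_row_sum: "(\<Sum>r\<in>UNIV. U $ p $ r) = 1"
proof -
  have "(U *v 1) $ p = 1"
    using U by (simp add: partition_matrices_def)
  then show ?thesis
    by (simp add: matrix_vector_mult_def)
qed

text \<open>Rows are nonnegative with sum 1, so a single entry 1 exhausts the row sum and forces all
  other entries to vanish: the row is one-hot.\<close>

lemma mem_community_iff: "p \<in> community U r \<longleftrightarrow> U $ p $ r = 1"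
proof
  assume "p \<in> community U r"
  then show "U $ p $ r = 1" by (simp add: community_def)
next
  assume r: "U $ p $ r = 1"
  have "(\<Sum>s\<in>UNIV - {r}. U $ p $ s) = 0"
    using partition_row_sum[of p] r by (simp add: sum.remove[of UNIV r])
  moreover have "0 \<le> U $ p $ s" for s
    using partition_entry[of p s] by auto
  ultimately have "\<forall>s\<in>UNIV - {r}. U $ p $ s = 0"
    by (simp add: sum_nonneg_eq_0_iff)
  then show "p \<in> community U r"
    using r by (auto simp: community_def vec_eq_iff axis_def)
qed

text \<open>Column \<open>r\<close> is the indicator function of its community, so sums over
  communities become weighted sums over all node-layer pairs.\<close>

lemma of_bool_mem_community: "of_bool (p \<in> community U r) = U $ p $ r"
  using partition_entry[of p r] by (auto simp: mem_community_iff)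

lemma sum_community:
  fixes f :: "'n \<times> 'l \<Rightarrow> real"
  shows "sum f (community U r) = (\<Sum>p\<in>UNIV. U $ p $ r * f p)"
proof -
  have "sum f (community U r) = (\<Sum>p\<in>UNIV. of_bool (p \<in> community U r) * f p)"
    by simp
  then show ?thesis by (simp only: of_bool_mem_community)
qed

lemma sum_Compl_community:
  fixes f :: "'n \<times> 'l \<Rightarrow> real"
  shows "sum f (- community U r) = (\<Sum>p\<in>UNIV. (1 - U $ p $ r) * f p)"
proof -
  have "sum f (- community U r) = sum f UNIV - sum f (community U r)"
    by (simp add: Compl_eq_Diff_UNIV sum_diff)
  then show ?thesis
    by (simp add: sum_community sum_subtractf left_diff_distrib)
qed

lemma sum_layer_community:
  fixes f :: "'n \<Rightarrow> real"
  shows "sum f (layer_community U r l) = (\<Sum>j\<in>UNIV. U $ (j, l) $ r * f j)"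
proof -
  have "sum f (layer_community U r l) = (\<Sum>j\<in>UNIV. of_bool ((j, l) \<in> community U r) * f j)"
    by (simp add: layer_community_def)
  then show ?thesis by (simp only: of_bool_mem_community)
qed

text \<open>A pair \<open>p\<close>, \<open>q\<close> enters the cut of community \<open>r\<close>
  with weight \<open>U $ p $ r * (1 - U $ q $ r)\<close>. Summed over \<open>r\<close>, the linear
  part gives 1 by the row sums, hence the total weight; the quadratic part is the trace.\<close>

lemma sum_mp_cut:
  "(\<Sum>r\<in>UNIV. mp_cut A At \<omega> (community U r) (- community U r)) =
    2 * edge_weight (supra_adjacency A At \<omega>)
      - trace (transpose U ** supra_adjacency A At \<omega> ** U)"
proof -
  let ?S = "supra_adjacency A At \<omega>"
  have "(\<Sum>r\<in>UNIV. mp_cut A At \<omega> (community U r) (- community U r)) =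
      (\<Sum>r\<in>UNIV. \<Sum>p\<in>UNIV. \<Sum>q\<in>UNIV. ?S $ p $ q * U $ p $ r - ?S $ p $ q * (U $ p $ r * U $ q $ r))"
    by (simp add: mp_cut_def sum_community sum_Compl_community sum_distrib_left algebra_simps)
  also have "\<dots> = (\<Sum>r\<in>UNIV. \<Sum>p\<in>UNIV. \<Sum>q\<in>UNIV. ?S $ p $ q * U $ p $ r)
      - trace (transpose U ** ?S ** U)"
    by (simp add: trace_congruence sum_subtractf)
  also have "(\<Sum>r\<in>UNIV. \<Sum>p\<in>UNIV. \<Sum>q\<in>UNIV. ?S $ p $ q * U $ p $ r) =
      (\<Sum>p\<in>UNIV. (\<Sum>q\<in>UNIV. ?S $ p $ q) * (\<Sum>r\<in>UNIV. U $ p $ r))"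
    by (subst sum.swap) (simp add: sum_distrib_left sum_distrib_right)
  finally show ?thesis
    by (simp add: partition_row_sum edge_weight_def one_inner_matrix_one)
qed

text \<open>For x and y in {0, 1} one has |x - y| = x + y - 2xy; summing over the row turns the two
  linear terms into 1 each.\<close>

lemma sum_abs_diff_rows:
  "(\<Sum>r\<in>UNIV. \<bar>U $ p $ r - U $ q $ r\<bar>) = 2 - 2 * (\<Sum>r\<in>UNIV. U $ p $ r * U $ q $ r)"
proof -
  have "\<bar>U $ p $ r - U $ q $ r\<bar> = U $ p $ r + U $ q $ r - 2 * (U $ p $ r * U $ q $ r)" for r
    using partition_entry[of p r] partition_entry[of q r] by auto
  then show ?thesis
    by (simp add: sum.distrib sum_subtractf partition_row_sum flip: sum_distrib_left)
qed

lemma mp_total_variation_eq: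
  "mp_total_variation A At \<omega> U =
    2 * edge_weight (supra_adjacency A At \<omega>)
      - trace (transpose U ** supra_adjacency A At \<omega> ** U)"
proof -
  let ?S = "supra_adjacency A At \<omega>"
  let ?f = "\<lambda>p q. ?S $ p $ q * (\<Sum>r\<in>UNIV. \<bar>U $ p $ r - U $ q $ r\<bar>)"
  have "mp_total_variation A At \<omega> U =
      1/2 * (\<Sum>i\<in>UNIV. \<Sum>j\<in>UNIV. \<Sum>k\<in>UNIV. \<Sum>l\<in>UNIV. ?f (i, k) (j, l))"
    by (simp add: mp_total_variation_def)
  \<comment> \<open>Exchanging \<open>j\<close> and \<open>k\<close> puts each node next to its
    layer, so that the four sums merge into two over node-layer pairs.\<close>
  also have "(\<Sum>i\<in>UNIV. \<Sum>j\<in>UNIV. \<Sum>k\<in>UNIV. \<Sum>l\<in>UNIV. ?f (i, k) (j, l)) =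
      (\<Sum>i\<in>UNIV. \<Sum>k\<in>UNIV. \<Sum>j\<in>UNIV. \<Sum>l\<in>UNIV. ?f (i, k) (j, l))"
    by (intro sum.cong refl sum.swap)
  also have "\<dots> = (\<Sum>p\<in>UNIV. \<Sum>q\<in>UNIV. ?f p q)"
    by (simp only: sum_UNIV_prod)
  also have "\<dots> = (\<Sum>p\<in>UNIV. \<Sum>q\<in>UNIV. 2 * ?S $ p $ q
      - 2 * (\<Sum>r\<in>UNIV. ?S $ p $ q * (U $ p $ r * U $ q $ r)))"
    by (simp add: sum_abs_diff_rows right_diff_distrib sum_distrib_left mult_ac)
  also have "\<dots> = 2 * (\<Sum>p\<in>UNIV. \<Sum>q\<in>UNIV. ?S $ p $ q)
      - 2 * (\<Sum>p\<in>UNIV. \<Sum>q\<in>UNIV. \<Sum>r\<in>UNIV. ?S $ p $ q * (U $ p $ r * U $ q $ r))"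
    by (simp only: sum_subtractf sum_distrib_left)
  also have "(\<Sum>p\<in>UNIV. \<Sum>q\<in>UNIV. \<Sum>r\<in>UNIV. ?S $ p $ q * (U $ p $ r * U $ q $ r)) =
      (\<Sum>p\<in>UNIV. \<Sum>r\<in>UNIV. \<Sum>q\<in>UNIV. ?S $ p $ q * (U $ p $ r * U $ q $ r))"
    by (intro sum.cong refl sum.swap)
  also have "\<dots> = trace (transpose U ** ?S ** U)"
    unfolding trace_congruence by (rule sum.swap)
  finally show ?thesis
    by (simp add: edge_weight_def one_inner_matrix_one)
qed

lemma volume_layer_community:
  "volume X (layer_community U r l) = (degree X v* layer_block U l) $ r"
  by (simp add: volume_def sum_layer_community vector_matrix_mult_def layer_block_def mult.commute)

text \<open>The volume does not depend on \<open>i\<close>, so the inner sum of degrees is the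
  volume once more. This leaves squared volumes, which are the squared entries of the row vector
  inside the norm.\<close>

lemma sum_volume_squares:
  "(\<Sum>r\<in>UNIV. \<Sum>i\<in>layer_community U r l. degree X $ i * volume X (layer_community U r l)) =
    (norm (degree X v* layer_block U l))\<^sup>2"
  by (simp add: volume_layer_community power2_norm_eq_inner inner_vec_def
      flip: sum_distrib_right volume_def)

lemma balanced_cut_eq_balanced_total_variation:
  "balanced_cut A At \<omega> \<gamma> U = balanced_total_variation A At \<omega> \<gamma> U"
proof -
  have "(\<Sum>r\<in>UNIV. \<Sum>l\<in>UNIV. \<gamma> l / (2 * edge_weight (A l))
         * (\<Sum>i\<in>layer_community U r l. degree (A l) $ i * volume (A l) (layer_community U r l)))
     = (\<Sum>l\<in>UNIV. \<gamma> l / (2 * edge_weight (A l)) * (norm (degree (A l) v* layer_block U l))\<^sup>2)"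
    by (subst sum.swap) (simp only: sum_volume_squares flip: sum_distrib_left)
  then show ?thesis
    by (simp add: balanced_cut_def balanced_total_variation_def sum_mp_cut mp_total_variation_eq)
qed

end

section \<open>The modularity matrix as a correction of the supra-adjacency matrix\<close>

lemma modularity_matrix_eq:
  assumes "\<And>l. At $ l $ l = 0"
  shows "modularity_matrix A At \<omega> \<gamma> $ (i, k) $ (j, l) = supra_adjacency A At \<omega> $ (i, k) $ (j, l)
    - (if k = l then \<gamma> l / (2 * edge_weight (A l)) * (degree (A l) $ i * degree (A l) $ j) else 0)"
  using assms
  by (simp add: modularity_matrix_def supra_adjacency_def blkdiag_def kronecker_def
      block_matrix_def layer_modularity_def)

text \<open>The correction is block diagonal with one rank-one block per layer, so on each column of
  \<open>U\<close> its quadratic form is a weighted sum of squares. Summing these over the columns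
  gives the squared norms.\<close>

lemma trace_modularity_matrix:
  fixes U :: "real^'c^('n::finite \<times> 'l::finite)"
  assumes "\<And>l. At $ l $ l = 0"
  shows "trace (transpose U ** modularity_matrix A At \<omega> \<gamma> ** U) =
    trace (transpose U ** supra_adjacency A At \<omega> ** U)
    - (\<Sum>l\<in>UNIV. \<gamma> l / (2 * edge_weight (A l)) * (norm (degree (A l) v* layer_block U l))\<^sup>2)"
proof -
  define c where "c l = \<gamma> l / (2 * edge_weight (A l))" for l
  define N where "N k l i j = (if k = l then c l * (degree (A l) $ i * degree (A l) $ j) else 0)"
    for k l i j
  let ?S = "supra_adjacency A At \<omega>"
  have M: "modularity_matrix A At \<omega> \<gamma> $ p $ q = ?S $ p $ q - N (snd p) (snd q) (fst p) (fst q)"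
    for p q
    using modularity_matrix_eq[OF assms, where i = "fst p" and k = "snd p" and j = "fst q" and l = "snd q"]
    by (simp add: N_def c_def)
  have block: "(\<Sum>p\<in>UNIV. \<Sum>q\<in>UNIV. N (snd p) (snd q) (fst p) (fst q) * (U $ p $ r * U $ q $ r)) =
      (\<Sum>l\<in>UNIV. c l * ((degree (A l) v* layer_block U l) $ r)\<^sup>2)" for r
  proof -
    have "(\<Sum>p\<in>UNIV. \<Sum>q\<in>UNIV. N (snd p) (snd q) (fst p) (fst q) * (U $ p $ r * U $ q $ r)) =
        (\<Sum>i\<in>UNIV. \<Sum>k\<in>UNIV. \<Sum>j\<in>UNIV. \<Sum>l\<in>UNIV. N k l i j * (U $ (i, k) $ r * U $ (j, l) $ r))"
      by (simp add: sum_UNIV_prod)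
    also have "\<dots> = (\<Sum>i\<in>UNIV. \<Sum>k\<in>UNIV. \<Sum>j\<in>UNIV.
        c k * (degree (A k) $ i * degree (A k) $ j) * (U $ (i, k) $ r * U $ (j, k) $ r))"
      \<comment> \<open>Moving the product into the conditional leaves a sum over \<open>l\<close>
        supported at \<open>l = k\<close>, which then collapses.\<close>
      by (simp add: N_def if_distrib[where f = "\<lambda>x. x * _"] cong: if_cong)
    also have "\<dots> = (\<Sum>k\<in>UNIV. \<Sum>i\<in>UNIV. \<Sum>j\<in>UNIV.
        c k * (degree (A k) $ i * degree (A k) $ j) * (U $ (i, k) $ r * U $ (j, k) $ r))"
      by (rule sum.swap)
    also have "\<dots> = (\<Sum>k\<in>UNIV. c k * ((degree (A k) v* layer_block U k) $ r)\<^sup>2)"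
      by (simp add: power2_eq_square vector_matrix_mult_def layer_block_def
          sum_product sum_distrib_left mult_ac)
    finally show ?thesis .
  qed
  have "trace (transpose U ** modularity_matrix A At \<omega> \<gamma> ** U) =
      trace (transpose U ** ?S ** U)
      - (\<Sum>r\<in>UNIV. \<Sum>l\<in>UNIV. c l * ((degree (A l) v* layer_block U l) $ r)\<^sup>2)"
    by (simp add: trace_congruence M left_diff_distrib sum_subtractf block)
  also have "(\<Sum>r\<in>UNIV. \<Sum>l\<in>UNIV. c l * ((degree (A l) v* layer_block U l) $ r)\<^sup>2) =
      (\<Sum>l\<in>UNIV. c l * (norm (degree (A l) v* layer_block U l))\<^sup>2)"
    unfolding power2_norm_eq_inner
    by (subst sum.swap) (simp add: inner_vec_def power2_eq_square flip: sum_distrib_left)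
  finally show ?thesis by (simp add: c_def)
qed

text \<open>The intra-layer blocks alone have positive total weight, and the coupling can only add
  to it. Positivity makes the factor 1/(2 \<mu>) in the modularity harmless.\<close>

lemma edge_weight_supra_adjacency_pos:
  fixes A :: "'l::finite \<Rightarrow> real^'n^'n"
  assumes A: "\<And>l i j. 0 \<le> A l $ i $ j" and At: "\<And>k l. 0 \<le> At $ k $ l" and \<omega>: "0 \<le> \<omega>"
    and pos: "\<And>l. 0 < 2 * edge_weight (A l)"
  shows "0 < 2 * edge_weight (supra_adjacency A At \<omega>)"
proof -
  let ?S = "supra_adjacency A At \<omega>"
  have S: "?S $ (i, k) $ (j, l) = (if k = l then A l $ i $ j else 0)
      + \<omega> * (At $ k $ l * (if i = j then 1 else 0))" for i j k l
    by (simp add: supra_adjacency_def blkdiag_def kronecker_def block_matrix_def mat_def)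
  have "0 < (\<Sum>l\<in>UNIV. 2 * edge_weight (A l))"
    using pos by (intro sum_pos) auto
  also have "\<dots> = (\<Sum>l\<in>UNIV. \<Sum>i\<in>UNIV. \<Sum>j\<in>UNIV. A l $ i $ j)"
    by (simp add: edge_weight_def one_inner_matrix_one)
  also have "\<dots> = (\<Sum>i\<in>UNIV. \<Sum>k\<in>UNIV. \<Sum>j\<in>UNIV. A k $ i $ j)"
    by (rule sum.swap)
  also have "\<dots> = (\<Sum>i\<in>UNIV. \<Sum>k\<in>UNIV. \<Sum>j\<in>UNIV. \<Sum>l\<in>UNIV. if k = l then A l $ i $ j else 0)"
    by simp
  \<comment> \<open>Entry by entry, the two sides differ by a coupling term, a product of
    nonnegative factors.\<close>
  also have "\<dots> \<le> (\<Sum>i\<in>UNIV. \<Sum>k\<in>UNIV. \<Sum>j\<in>UNIV. \<Sum>l\<in>UNIV. ?S $ (i, k) $ (j, l))"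
    using At \<omega> by (intro sum_mono) (simp add: S)
  also have "\<dots> = 2 * edge_weight ?S"
    by (simp add: edge_weight_def one_inner_matrix_one sum_UNIV_prod)
  finally show ?thesis .
qed

theorem proposition4p1:
  fixes A :: "'l::finite \<Rightarrow> real^'n^'n"
    and At :: "real^'l^'l"
    and \<omega> :: real
    and \<gamma> :: "'l \<Rightarrow> real"
  assumes "\<And>l i j. 0 \<le> A l $ i $ j"
    and "\<And>l. transpose (A l) = A l"
    and "\<And>k l. 0 \<le> At $ k $ l"
    and "transpose At = At"
    and "\<And>l. At $ l $ l = 0"
    and "0 \<le> \<omega>"
    and "\<And>l. 0 < 2 * edge_weight (A l)"
    and "\<And>l. 0 < \<gamma> l"
  shows "{U :: real^'c^('n \<times> 'l). is_arg_max (modularity A At \<omega> \<gamma>) (\<lambda>U. U \<in> partition_matrices) U}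
       = {U. is_arg_min (balanced_cut A At \<omega> \<gamma>) (\<lambda>U. U \<in> partition_matrices) U}
    \<and> {U :: real^'c^('n \<times> 'l). is_arg_min (balanced_cut A At \<omega> \<gamma>) (\<lambda>U. U \<in> partition_matrices) U}
       = {U. is_arg_min (balanced_total_variation A At \<omega> \<gamma>) (\<lambda>U. U \<in> partition_matrices) U}"
proof -
  let ?c = "2 * edge_weight (supra_adjacency A At \<omega>)"
  let ?P = "\<lambda>U :: real^'c^('n \<times> 'l). U \<in> partition_matrices"
  have c: "0 < ?c"
    using assms by (intro edge_weight_supra_adjacency_pos)
  have cut_tv: "is_arg_min (balanced_cut A At \<omega> \<gamma>) ?P =
      is_arg_min (balanced_total_variation A At \<omega> \<gamma>) ?P"
    by (intro is_arg_min_cong balanced_cut_eq_balanced_total_variation)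
  \<comment> \<open>Since \<open>?c\<close> is nonzero, it cancels the normalisation in
    \<open>modularity\<close> and leaves the bare trace; the penalty is exactly the difference of
    the two traces.\<close>
  have "balanced_total_variation A At \<omega> \<gamma> U = ?c - ?c * modularity A At \<omega> \<gamma> U" if "?P U" for U
    using c trace_modularity_matrix[of At U A \<omega> \<gamma>, OF assms(5)]
    by (simp add: balanced_total_variation_def mp_total_variation_eq[OF that] modularity_def)
  from is_arg_max_iff_is_arg_min[OF c, of ?P, OF this]
  show ?thesis by (simp add: cut_tv)
qed

end
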